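(* Let $p,q>0$ and let $z_0$ be the largest root of the polynomial $$G(x)=x^4-\frac{4pq(q+1)}{p+1}x^2+\frac{2pq(q+1)(p+q+2)}{(p+1)^2}x-\frac{pq(q+1)^2}{(p+1)^2}.$$ (i) If $q>\frac13$ and $p>\frac{q+1}{3q-1}$, then $G<0$ in $\left[\frac{q+1}{2},z_0\right)$, $pq>1$, and $z_0>\frac{q+1}{2}+\frac1\alpha$. (ii) If $p,q\ge1$ and $pq\ne1$, then $p>\frac{q+1}{3q-1}$, $q>\frac13$, and $z_0>\frac{q+1}{2}+\frac3\alpha$.
   Context: For $pq\neq1$, $\alpha=\frac{2(p+1)}{pq-1}$. "Largest root" means largest real root. *)

theory Defs
  imports Complex_Main "HOL-Computational_Algebra.Polynomial"
begin

text \<open>Coefficients are listed from the constant term upwards.\<close>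

definition G :: "real \<Rightarrow> real \<Rightarrow> real poly" where
  "G p q = [: - (p * q * (q + 1)^2 / (p + 1)^2),
              2 * p * q * (q + 1) * (p + q + 2) / (p + 1)^2,
              - (4 * p * q * (q + 1) / (p + 1)),
              0,
              1 :]"

text \<open>The maximum is taken over the real roots only. It is meaningful when this set is finite and
  nonempty, as it is for \<open>G p q\<close> with \<open>p, q > 0\<close>: the polynomial is monic of even degree and
  negative at \<open>0\<close>.\<close>

definition largest_root :: "real poly \<Rightarrow> real" where
  "largest_root P = Max {x. poly P x = 0}"

text \<open>Meant for \<open>p * q \<noteq> 1\<close>.\<close>

definition alpha :: "real \<Rightarrow> real \<Rightarrow> real" where
  "alpha p q = 2 * (p + 1) / (p * q - 1)"

end

theory Submission
  imports Defs
begin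

text \<open>With \<open>m = p q\<close>, \<open>y = (p + 1) (q + 1)\<close> and \<open>x = X / (2 (p + 1))\<close>, the value \<open>G(x)\<close> is a positive
  multiple of a quartic \<open>H m y X\<close>, and the point \<open>(q + 1) / 2 + k / \<alpha>\<close> corresponds to
  \<open>X = y + k (m - 1)\<close>. The condition \<open>p > (q + 1) / (3 q - 1)\<close> says precisely \<open>y < 4 m\<close>. In that case
  the Taylor coefficients of \<open>H\<close> at \<open>X = y\<close> of orders 0 and 1 are negative and those of orders 3 and 4
  are positive, so \<open>H m y (y + T) / T\<^sup>2\<close> is increasing in \<open>T > 0\<close> and \<open>G\<close> changes sign only once
  beyond \<open>(q + 1) / 2\<close>. Hence \<open>z\<^sub>0\<close> exceeds any point at which \<open>G\<close> is negative. The
  negativity at \<open>k = 1\<close> and \<open>k = 3\<close> is seen by expanding in \<open>a = p + q - 2 \<ge> 0\<close> and the slack \<open>n\<close> of the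
  lower bound for \<open>m\<close>: all coefficients then have the same sign.\<close>

text \<open>\<open>P\<close> is eventually positive, so the intermediate value theorem yields a root
  beyond \<open>u\<close>; the maximum dominates it because a nonzero polynomial has finitely many
  roots.\<close>

lemma less_largest_root:
  fixes P :: "real poly"
  assumes "lead_coeff P > 0" and "poly P u < 0"
  shows "u < largest_root P"
proof -
  obtain n where n: "\<And>x. x \<ge> n \<Longrightarrow> poly P x \<ge> lead_coeff P"
    using poly_pinfty_gt_lc[OF assms(1)] by blast
  define v where "v = max n (u + 1)"
  have "poly P v > 0"
    using n[of v] assms(1) by (simp add: v_def)
  moreover have "u < v"
    by (simp add: v_def)
  ultimately obtain z where z: "u < z" "poly P z = 0"
    using poly_IVT_pos[of u v P] assms(2) by blast
  have "P \<noteq> 0"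
    using assms(1) by auto
  then have "z \<le> largest_root P"
    using z(2) by (simp add: largest_root_def poly_roots_finite)
  with z(1) show ?thesis
    by simp
qed

lemma poly_largest_root:
  assumes "P \<noteq> 0" and "poly P x = 0"
  shows "poly P (largest_root P) = 0"
proof -
  have "Max {x. poly P x = 0} \<in> {x. poly P x = 0}"
    using assms by (intro Max_in) (auto intro: poly_roots_finite)
  then show ?thesis
    by (simp add: largest_root_def)
qed

definition H :: "real \<Rightarrow> real \<Rightarrow> real \<Rightarrow> real" where
  "H m y X = X^4 - 16 * m * y * X^2 + 16 * m * y * (y - m + 1) * X - 16 * m * y^2"

lemma lead_coeff_G: "lead_coeff (G p q) = 1"
  by (simp add: G_def)

lemma poly_G_eq_H:
  assumes "p > 0"
  shows "poly (G p q) x = H (p * q) ((p + 1) * (q + 1)) (2 * (p + 1) * x) / (16 * (p + 1)^4)"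
proof -
  have clear_denominators: "16 * P^4 * (x^4 - A / P * x^2 + B / P^2 * x - C / P^2) =
      16 * P^4 * x^4 - 16 * P^3 * A * x^2 + 16 * P^2 * B * x - 16 * P^2 * C"
    if "P \<noteq> 0" for P A B C :: real
    using that by (simp add: field_simps power2_eq_square power3_eq_cube power4_eq_xxxx)
  have "poly (G p q) x = x^4 - (4 * p * q * (q + 1)) / (p + 1) * x^2
      + (2 * p * q * (q + 1) * (p + q + 2)) / (p + 1)^2 * x
      - (p * q * (q + 1)^2) / (p + 1)^2"
    unfolding G_def by (simp only: poly_pCons poly_0) algebra
  then have "16 * (p + 1)^4 * poly (G p q) x = 16 * (p + 1)^4 * x^4
      - 16 * (p + 1)^3 * (4 * p * q * (q + 1)) * x^2
      + 16 * (p + 1)^2 * (2 * p * q * (q + 1) * (p + q + 2)) * x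
      - 16 * (p + 1)^2 * (p * q * (q + 1)^2)"
    using assms by (subst clear_denominators[symmetric]) auto
  also have "\<dots> = H (p * q) ((p + 1) * (q + 1)) (2 * (p + 1) * x)"
    unfolding H_def by algebra
  finally show ?thesis
    using assms by (simp add: eq_divide_eq mult.commute)
qed

lemma poly_G_neg_iff:
  assumes "p > 0"
  shows "poly (G p q) x < 0 \<longleftrightarrow> H (p * q) ((p + 1) * (q + 1)) (2 * (p + 1) * x) < 0"
  using assms by (simp add: poly_G_eq_H divide_less_0_iff)

lemma H_single_sign_change:
  assumes "m > 1" and "y > 0" and "y < 4 * m" and "y \<le> X" and "X < Z" and "H m y X \<ge> 0"
  shows "H m y Z > 0"
proof -
  define h0 where "h0 = y^2 * (y + 4 * m) * (y - 4 * m)"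
  define h1 where "h1 = 4 * y * (y * (y - 4 * m) - 4 * m * (m - 1))"
  define h2 where "h2 = 6 * y^2 - 16 * m * y"
  have taylor: "H m y (y + t) = h0 + h1 * t + h2 * t^2 + 4 * y * t^3 + t^4" for t
    unfolding H_def h0_def h1_def h2_def by algebra
  have "h0 < 0"
    unfolding h0_def using assms by (intro mult_pos_neg) auto
  have "y * (y - 4 * m) < 0" "4 * m * (m - 1) > 0"
    using assms by (auto intro: mult_pos_neg)
  then have "h1 < 0"
    unfolding h1_def using assms(2) by (intro mult_pos_neg) auto
  define S where "S = X - y"
  define T where "T = Z - y"
  have HX: "H m y X = h0 + h1 * S + h2 * S^2 + 4 * y * S^3 + S^4"
    using taylor[of S] by (simp add: S_def)
  have HZ: "H m y Z = h0 + h1 * T + h2 * T^2 + 4 * y * T^3 + T^4"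
    using taylor[of T] by (simp add: T_def)
  have "S \<noteq> 0"
    using HX assms(6) \<open>h0 < 0\<close> by auto
  then have "S > 0" "T > S"
    using assms by (auto simp: S_def T_def)
  \<comment> \<open>Comparing the quotients by \<open>S^2\<close> and \<open>T^2\<close> cancels the
    terms with \<open>h2\<close>, the only Taylor coefficient of unknown sign.\<close>
  have "S^2 * H m y Z = T^2 * H m y X
      + (- h0) * ((T - S) * (T + S)) + (- h1) * (S * T * (T - S))
      + 4 * y * (S^2 * T^2 * (T - S)) + S^2 * T^2 * ((T - S) * (T + S))"
    unfolding HX HZ by algebra
  also have "\<dots> > 0"
    using \<open>S > 0\<close> \<open>T > S\<close> \<open>h0 < 0\<close> \<open>h1 < 0\<close> assms(2,6)
    by (intro add_nonneg_pos add_nonneg_nonneg mult_nonneg_nonneg mult_pos_pos) auto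
  finally show ?thesis
    using \<open>S > 0\<close> by (simp add: zero_less_mult_iff)
qed

text \<open>Here \<open>w\<close> stands for \<open>p + q\<close>, so that \<open>m + w + 1\<close>
  is \<open>y\<close> and \<open>3 * m > w + 1\<close> is \<open>y < 4 * m\<close>.\<close>

lemma H_neg_1:
  fixes m w :: real
  assumes "w \<ge> 2" and "3 * m > w + 1"
  shows "H m (m + w + 1) (m + w + 1 + (m - 1)) < 0"
proof -
  define a where "a = w - 2"
  define n where "n = m - (w + 1) / 3"
  have "a \<ge> 0" "n > 0"
    using assms by (auto simp: a_def n_def)
  have mw: "m = 1 + a / 3 + n" "w = 2 + a"
    by (auto simp: a_def n_def field_simps)
  \<comment> \<open>The expression vanishes at \<open>a = n = 0\<close>, that is, at
    \<open>p = q = 1\<close>, so strictness comes from the term \<open>384 * n\<close>.\<close>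
  have "- H m (m + w + 1) (m + w + 1 + (m - 1)) =
      384 * n + 656 * n^2 + 336 * n^3 + 48 * n^4 + 1408 / 3 * (a * n) + 528 * (a * n^2)
      + 128 * (a * n^3) + 32 / 9 * a^2 + 192 * (a^2 * n) + 104 * (a^2 * n^2) + 16 / 9 * a^3
      + 232 / 9 * (a^3 * n) + 5 / 27 * a^4"
    unfolding H_def mw by (simp add: field_simps) algebra
  also have "\<dots> > 0"
    using \<open>a \<ge> 0\<close> \<open>n > 0\<close> by (intro add_pos_nonneg) auto
  finally show ?thesis
    by simp
qed

text \<open>With \<open>w\<close> again for \<open>p + q\<close>, the bound
  \<open>m \<ge> w - 1\<close> is \<open>(p - 1) * (q - 1) \<ge> 0\<close>.\<close>

lemma H_neg_3:
  fixes m w :: real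
  assumes "w \<ge> 2" and "m \<ge> w - 1" and "m > 1"
  shows "H m (m + w + 1) (m + w + 1 + 3 * (m - 1)) < 0"
proof -
  define a where "a = w - 2"
  define n where "n = m - (w - 1)"
  have mw: "m = 1 + a + n" "w = 2 + a"
    by (auto simp: a_def n_def)
  have "- H m (m + w + 1) (m + w + 1 + 3 * (m - 1)) =
      (384 * n + 256 * a) + (912 * n^2 + 528 * n^3 + 1728 * (a * n) + 1680 * (a * n^2)
      + 64 * (a * n^3) + 736 * a^2 + 1664 * (a^2 * n) + 160 * (a^2 * n^2) + 496 * a^3
      + 112 * (a^3 * n) + 15 * a^4)"
    unfolding H_def mw by algebra
  also have "\<dots> > 0"
  \<comment> \<open>Now \<open>n = 0\<close> is possible, but \<open>a + n = m - 1 > 0\<close>, so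
    the two linear terms together are positive.\<close>
  proof (rule add_pos_nonneg)
    show "384 * n + 256 * a > 0"
      using assms by (auto simp: a_def n_def)
  qed (use assms in \<open>auto simp: a_def n_def\<close>)
  finally show ?thesis
    by simp
qed

lemma less_largest_root_G:
  assumes "p > 0" and "H (p * q) (p * q + (p + q) + 1) (p * q + (p + q) + 1 + k * (p * q - 1)) < 0"
  shows "(q + 1) / 2 + k / alpha p q < largest_root (G p q)"
proof (rule less_largest_root)
  have y: "p * q + (p + q) + 1 = (p + 1) * (q + 1)"
    by algebra
  \<comment> \<open>This also covers \<open>p * q = 1\<close>: division by zero then gives
    \<open>alpha p q = 0\<close> and \<open>k / alpha p q = 0\<close>.\<close>
  have "2 * (p + 1) * ((q + 1) / 2 + k / alpha p q) = (p + 1) * (q + 1) + k * (p * q - 1)"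
    using assms(1) by (simp add: alpha_def field_simps)
  then show "poly (G p q) ((q + 1) / 2 + k / alpha p q) < 0"
    using assms by (simp only: poly_G_neg_iff y)
qed (simp add: lead_coeff_G)

lemma mult_greater_1_if_3_mult_greater:
  fixes p q :: real
  assumes "p > 0" and "q > 0" and "3 * (p * q) > p + q + 1"
  shows "p + q > 2" and "p * q > 1"
proof -
  have "(p - q)^2 \<ge> 0"
    by simp
  then have "(p + q)^2 \<ge> 4 * (p * q)"
    by (simp add: power2_eq_square algebra_simps)
  \<comment> \<open>With \<open>s = p + q\<close>, the hypothesis gives
    \<open>3 * s^2 \<ge> 12 * (p * q) > 4 * (s + 1)\<close>, and \<open>3 * s^2 - 4 * s - 4\<close>
    factors in this way.\<close>
  then have "(3 * (p + q) + 2) * (p + q - 2) > 0"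
    using assms(3) by (simp add: power2_eq_square algebra_simps)
  then show "p + q > 2"
    using assms(1,2) by (simp add: zero_less_mult_iff)
  with assms(3) show "p * q > 1"
    by linarith
qed

text \<open>A nonnegative value at \<open>x\<close> would, by the single sign change, make
  \<open>G p q\<close> positive at its own largest root.\<close>

lemma poly_G_neg:
  assumes "p > 0" and "q > 0" and "3 * (p * q) > p + q + 1"
    and "(q + 1) / 2 \<le> x" and "x < largest_root (G p q)"
  shows "poly (G p q) x < 0"
proof (rule ccontr)
  assume nonneg: "\<not> poly (G p q) x < 0"
  let ?z = "largest_root (G p q)"
  let ?H = "H (p * q) ((p + 1) * (q + 1))"
  have "p + 1 > 0"
    using assms(1) by simp
  have "?H (2 * (p + 1) * ?z) > 0"
  proof (rule H_single_sign_change)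
    show "p * q > 1"
      using mult_greater_1_if_3_mult_greater assms by blast
    show "(p + 1) * (q + 1) > 0"
      using assms by simp
    show "(p + 1) * (q + 1) < 4 * (p * q)"
      using assms(3) by (simp add: algebra_simps)
    have "(p + 1) * (q + 1) \<le> (p + 1) * (2 * x)"
      using assms(4) \<open>p + 1 > 0\<close> by (intro mult_left_mono) auto
    then show "(p + 1) * (q + 1) \<le> 2 * (p + 1) * x"
      by (simp only: mult_ac)
    show "2 * (p + 1) * x < 2 * (p + 1) * ?z"
      using assms(5) \<open>p + 1 > 0\<close> by simp
    show "?H (2 * (p + 1) * x) \<ge> 0"
      using nonneg assms(1) by (simp add: poly_G_neg_iff)
  qed
  then have "poly (G p q) ?z > 0"
    using assms(1) by (simp add: poly_G_eq_H)
  moreover have "poly (G p q) ?z = 0"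
  proof -
    \<comment> \<open>A real root has to be exhibited, since only then is the maximum of the root
      set itself a root.\<close>
    have "poly (G p q) 0 < 0"
      using assms(1,2) by (simp add: G_def)
    moreover obtain n where "\<And>x. x \<ge> n \<Longrightarrow> poly (G p q) x \<ge> 1"
      using poly_pinfty_gt_lc[of "G p q"] by (auto simp: lead_coeff_G)
    then have "poly (G p q) (max n 1) > 0"
      by (meson less_le_trans max.cobounded1 zero_less_one)
    ultimately obtain r where "poly (G p q) r = 0"
      using poly_IVT_pos[of 0 "max n 1" "G p q"] by (auto simp: less_max_iff_disj)
    then show ?thesis
      by (rule poly_largest_root[rotated]) (simp add: G_def)
  qed
  ultimately show False
    by simp
qed

theorem proposition1p7:
  fixes p q z0 :: real
  assumes "p > 0" and "q > 0"
    and "z0 = largest_root (G p q)"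
  shows "(q > 1/3 \<and> p > (q + 1) / (3 * q - 1) \<longrightarrow>
           (\<forall>x\<in>{(q + 1) / 2..<z0}. poly (G p q) x < 0) \<and>
           p * q > 1 \<and>
           z0 > (q + 1) / 2 + 1 / alpha p q) \<and>
         (p \<ge> 1 \<and> q \<ge> 1 \<and> p * q \<noteq> 1 \<longrightarrow>
           p > (q + 1) / (3 * q - 1) \<and>
           q > 1/3 \<and>
           z0 > (q + 1) / 2 + 3 / alpha p q)"
proof (intro conjI[of "_ \<longrightarrow> _"] impI)
  assume "q > 1/3 \<and> p > (q + 1) / (3 * q - 1)"
  then have "q + 1 < p * (3 * q - 1)"
    using pos_divide_less_eq[of "3 * q - 1" "q + 1" p] by linarith
  then have m: "3 * (p * q) > p + q + 1"
    by (simp add: algebra_simps)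
  note gt = mult_greater_1_if_3_mult_greater[OF assms(1,2) m]
  have "H (p * q) (p * q + (p + q) + 1) (p * q + (p + q) + 1 + (p * q - 1)) < 0"
    using H_neg_1 gt(1) m by simp
  then have "z0 > (q + 1) / 2 + 1 / alpha p q"
    using less_largest_root_G[of p q 1] assms by simp
  then show "(\<forall>x\<in>{(q + 1) / 2..<z0}. poly (G p q) x < 0) \<and> p * q > 1 \<and>
      z0 > (q + 1) / 2 + 1 / alpha p q"
    using poly_G_neg[OF assms(1,2) m] gt(2) assms(3) by simp
next
  assume *: "p \<ge> 1 \<and> q \<ge> 1 \<and> p * q \<noteq> 1"
  then have "1 * 1 \<le> p * q"
    by (intro mult_mono) auto
  with * have gt: "p * q > 1"
    by simp
  have "(p - 1) * (q - 1) \<ge> 0"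
    using * by simp
  then have ge: "p * q \<ge> p + q - 1"
    by (simp add: algebra_simps)
  have "H (p * q) (p * q + (p + q) + 1) (p * q + (p + q) + 1 + 3 * (p * q - 1)) < 0"
    using * gt ge by (intro H_neg_3) auto
  then have "z0 > (q + 1) / 2 + 3 / alpha p q"
    using less_largest_root_G[of p q 3] assms by simp
  \<comment> \<open>Adding twice \<open>p * q > 1\<close> to \<open>p * q \<ge> p + q - 1\<close>
    gives \<open>3 * (p * q) > p + q + 1\<close>.\<close>
  moreover have "p > (q + 1) / (3 * q - 1)"
    using * gt ge by (simp add: field_simps)
  ultimately show "p > (q + 1) / (3 * q - 1) \<and> q > 1/3 \<and> z0 > (q + 1) / 2 + 3 / alpha p q"
    using * by simp
qed

end
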